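(* The detection boundary $\rho_{\mathrm{FDR}}(\beta)$ of the false discovery rate (FDR)-controlling procedure is $$\rho_{\mathrm{FDR}}(\beta)=(1-\sqrt{1-\beta})^2,\qquad \tfrac12<\beta<1 .$$ That is: let $\beta\in(\tfrac12,1)$, $r\in(0,1)$, $\varepsilon_n=n^{-\beta}$, $\mu_n=\sqrt{2r\log(n)}$, and let $\alpha_n\in(0,1)$ be a sequence of levels tending to $0$ slowly enough. Then, as $n\to\infty$, (1) if $r>(1-\sqrt{1-\beta})^2$, then $P_{H_1^{(n)}}\{\text{the FDR procedure at level }\alpha_n\text{ rejects }H_0\}\to1$; (2) if $r<(1-\sqrt{1-\beta})^2$, then $P_{H_1^{(n)}}\{\text{the FDR procedure at level }\alpha_n\text{ rejects }H_0\}\to0$.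
   Context: Hypotheses: under $H_0$, $X_1,\dots,X_n$ are i.i.d. $N(0,1)$; under $H_1^{(n)}$, $X_1,\dots,X_n$ are i.i.d. from the mixture $(1-\varepsilon_n)N(0,1)+\varepsilon_nN(\mu_n,1)$. Let $p_i=P\{N(0,1)>X_i\}$ be the $p$-values and $p_{(1)}\le\dots\le p_{(n)}$ the sorted $p$-values. The FDR-controlling (Benjamini–Hochberg) procedure at level $\alpha$, viewed as a test of the intersection null hypothesis $H_0$, rejects $H_0$ if and only if there is some $k\in\{1,\dots,n\}$ such that the $k$ smallest $p$-values are all at most $\alpha k/n$, i.e. if and only if $\min_{1\le k\le n}\frac{p_{(k)}}{k/n}\le\alpha$. A sequence of levels $\alpha_n\to0$ is said to tend to $0$ slowly enough if $\log(1/\alpha_n)=o(\log n)$. *)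

theory Defs
  imports "HOL-Probability.Probability"
begin

definition normal_mixture :: "real \<Rightarrow> real \<Rightarrow> real measure" where
  "normal_mixture \<epsilon> \<mu> =
     density lborel (\<lambda>x. ennreal ((1 - \<epsilon>) * std_normal_density x + \<epsilon> * normal_density \<mu> 1 x))"

definition iid_sample :: "'a measure \<Rightarrow> nat \<Rightarrow> (nat \<Rightarrow> 'a \<Rightarrow> real) \<Rightarrow> real measure \<Rightarrow> bool" where
  "iid_sample M n X D \<longleftrightarrow>
     prob_space M \<and>
     prob_space.indep_vars M (\<lambda>_. borel) X {1..n} \<and>
     (\<forall>i\<in>{1..n}. distr M borel (X i) = D)"

definition p_value :: "real \<Rightarrow> real" where
  "p_value x = measure std_normal_distribution {x<..}"

(* Lists are 0-indexed, so the k-th smallest p-value p_(k) is element k - 1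
   of the increasingly sorted list. *)
definition sorted_p_value :: "nat \<Rightarrow> (nat \<Rightarrow> real) \<Rightarrow> nat \<Rightarrow> real" where
  "sorted_p_value n x k = sort (map (\<lambda>i. p_value (x i)) [1..<Suc n]) ! (k - 1)"

definition FDR_rejects :: "real \<Rightarrow> nat \<Rightarrow> (nat \<Rightarrow> real) \<Rightarrow> bool" where
  "FDR_rejects \<alpha> n x \<longleftrightarrow> (\<exists>k\<in>{1..n}. sorted_p_value n x k \<le> \<alpha> * real k / real n)"

definition tends_to_0_slowly_enough :: "(nat \<Rightarrow> real) \<Rightarrow> bool" where
  "tends_to_0_slowly_enough \<alpha> \<longleftrightarrow>
     \<alpha> \<longlonglongrightarrow> 0 \<and> (\<lambda>n. ln (1 / \<alpha> n)) \<in> o(\<lambda>n. ln (real n))"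

end

theory Submission
  imports Defs "HOL-Real_Asymp.Real_Asymp"
begin

text \<open>
  Above the boundary already the smallest \<open>p\<close>-value suffices: with \<open>T = b \<surd>(2 log n)\<close> for some \<open>b > 1\<close>
  close to \<open>1\<close>, every observation beyond \<open>T\<close> has \<open>p\<close>-value at most \<open>\<alpha>\<^sub>n / n\<close>, and the expected number
  of such observations from the shifted component tends to infinity.

  Below the boundary take \<open>T = \<surd>(2 log n)\<close>. The likelihood ratio of the shifted component is at
  most \<open>exp (\<mu> T - \<mu>\<^sup>2 / 2)\<close> below \<open>T\<close>, and its mass above \<open>T\<close> is at most \<open>exp (- (T - \<mu>)\<^sup>2 / 2)\<close>.
  Multiplied by \<open>\<epsilon>\<close> and \<open>n \<epsilon>\<close> respectively, both become \<open>n\<close> to the power \<open>2 \<surd>r - r - \<beta> < 0\<close>.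
  Hence the expected number of \<open>p\<close>-values below \<open>\<alpha>\<^sub>n k / n\<close> is at most \<open>\<delta>\<^sub>n k\<close> with \<open>\<delta>\<^sub>n \<rightarrow> 0\<close>
  uniformly in \<open>k\<close>, and a union bound over \<open>k\<close> gives a geometric series of ratio \<open>e \<delta>\<^sub>n\<close>.
\<close>

section \<open>Order statistics and the rejection event\<close>

text \<open>The entries of a sorted list that are at most \<open>u\<close> form an initial segment,
  so their number decides which positions lie in it.\<close>

lemma sorted_nth_le_iff:
  fixes ys :: "'a::linorder list"
  assumes "sorted ys" "k < length ys"
  shows "ys ! k \<le> u \<longleftrightarrow> k < length (filter (\<lambda>y. y \<le> u) ys)"
  using assms
proof (induction ys arbitrary: k)
  case (Cons y ys)
  show ?case
  proof (cases "y \<le> u")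
    case True
    with Cons show ?thesis by (cases k) auto
  next
    case False
    with Cons.prems have "filter (\<lambda>y. y \<le> u) (y # ys) = []"
      by (auto simp: filter_empty_conv)
    moreover have "y \<le> (y # ys) ! k"
      using Cons.prems by (cases k) auto
    ultimately show ?thesis using False by auto
  qed
qed simp

text \<open>Sorting permutes the p-values and so preserves how many are at most \<open>u\<close>;
  order statistics are thereby replaced by counts.\<close>

lemma sorted_p_value_le_iff:
  assumes "k \<in> {1..n}"
  shows "sorted_p_value n x k \<le> u \<longleftrightarrow> k \<le> card {i\<in>{1..n}. p_value (x i) \<le> u}"
proof -
  let ?P = "\<lambda>y. y \<le> u"
  let ?xs = "map (\<lambda>i. p_value (x i)) [1..<Suc n]"
  have "length (filter ?P (sort ?xs)) = length (filter (\<lambda>i. p_value (x i) \<le> u) [1..<Suc n])"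
    by (simp only: filter_sort length_sort filter_map length_map comp_def)
  also have "\<dots> = card (set (filter (\<lambda>i. p_value (x i) \<le> u) [1..<Suc n]))"
    by (rule distinct_card[symmetric]) simp
  also have "set (filter (\<lambda>i. p_value (x i) \<le> u) [1..<Suc n]) = {i\<in>{1..n}. p_value (x i) \<le> u}"
    by auto
  finally have count: "length (filter ?P (sort ?xs)) = card {i\<in>{1..n}. p_value (x i) \<le> u}" .
  have "sort ?xs ! (k - 1) \<le> u \<longleftrightarrow> k - 1 < length (filter ?P (sort ?xs))"
    using assms by (intro sorted_nth_le_iff) (auto simp del: upt_Suc)
  \<comment> \<open>The shift from the 0-indexed position \<open>k - 1\<close> back to the rank
    \<open>k\<close> relies on \<open>k\<close> being at least 1, since subtraction on naturals
    truncates.\<close>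
  also have "\<dots> \<longleftrightarrow> k \<le> length (filter ?P (sort ?xs))"
    using assms unfolding atLeastAtMost_iff by linarith
  finally show ?thesis
    unfolding sorted_p_value_def count .
qed

text \<open>Naming the set \<open>S\<close> of small p-values writes rejection as a finite union of
  events, each an intersection over distinct observations. This form serves measurability,
  independence and the union bound.\<close>

lemma FDR_rejects_iff:
  "FDR_rejects \<alpha> n x \<longleftrightarrow>
    (\<exists>k\<in>{1..n}. \<exists>S\<in>{S. S \<subseteq> {1..n} \<and> card S = k}. \<forall>i\<in>S. p_value (x i) \<le> \<alpha> * real k / real n)"
proof -
  have "k \<le> card {i\<in>{1..n}. p_value (x i) \<le> u} \<longleftrightarrow>
      (\<exists>S\<in>{S. S \<subseteq> {1..n} \<and> card S = k}. \<forall>i\<in>S. p_value (x i) \<le> u)" (is "?L \<longleftrightarrow> ?R") for k u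
  proof
    assume ?L
    from obtain_subset_with_card_n[OF this]
    obtain S where "S \<subseteq> {i\<in>{1..n}. p_value (x i) \<le> u}" "card S = k" by blast
    then show ?R by blast
  next
    assume ?R
    then obtain S where S: "S \<subseteq> {1..n}" "card S = k" "\<forall>i\<in>S. p_value (x i) \<le> u" by blast
    then have "S \<subseteq> {i\<in>{1..n}. p_value (x i) \<le> u}" by auto
    then have "card S \<le> card {i\<in>{1..n}. p_value (x i) \<le> u}" by (intro card_mono) auto
    with S show ?L by simp
  qed
  then show ?thesis
    unfolding FDR_rejects_def by (simp add: sorted_p_value_le_iff)
qed

section \<open>Normal measures: change of measure and tail bounds\<close>

text \<open>A likelihood ratio bound on \<open>A\<close> integrates to a bound on measures. It is
  applied below with \<open>c\<close> the ratio at the endpoint of a half-line.\<close>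

lemma measure_density_le_mult:
  fixes f g :: "real \<Rightarrow> real"
  assumes [measurable]: "f \<in> borel_measurable borel" "g \<in> borel_measurable borel" "A \<in> sets borel"
    and "finite_measure (density lborel g)" "0 \<le> c"
    and le: "\<And>x. x \<in> A \<Longrightarrow> f x \<le> c * g x"
  shows "measure (density lborel f) A \<le> c * measure (density lborel g) A"
proof -
  interpret g: finite_measure "density lborel g" by fact
  have "emeasure (density lborel f) A = (\<integral>\<^sup>+x. ennreal (f x) * indicator A x \<partial>lborel)"
    by (simp add: emeasure_density)
  also have "\<dots> \<le> (\<integral>\<^sup>+x. ennreal c * (ennreal (g x) * indicator A x) \<partial>lborel)"
    using le \<open>0 \<le> c\<close> by (intro nn_integral_mono)
      (auto simp: indicator_def ennreal_mult'[symmetric] intro!: ennreal_leI)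
  also have "\<dots> = ennreal c * emeasure (density lborel g) A"
    by (simp add: nn_integral_cmult emeasure_density)
  also have "\<dots> = ennreal (c * measure (density lborel g) A)"
    using \<open>0 \<le> c\<close> by (simp add: g.emeasure_eq_measure ennreal_mult')
  finally show ?thesis
    using \<open>0 \<le> c\<close> by (simp add: measure_def enn2real_leI)
qed

abbreviation normal_distribution :: "real \<Rightarrow> real measure" where
  "normal_distribution \<mu> \<equiv> density lborel (normal_density \<mu> 1)"

lemma prob_space_normal: "prob_space (normal_distribution \<mu>)"
  by (rule prob_space_normal_density) simp

text \<open>The exponential factor is the likelihood ratio of two unit-variance normals. It is
  monotone in \<open>x\<close>, so on a half-line it is extremal at the endpoint. The centre \<nu>
  is \<open>T\<close> in the tail bound and 0 in the comparison with the null.\<close>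

lemma normal_density_tilt:
  "normal_density \<mu> 1 x = exp ((\<mu> - \<nu>) * (x - \<nu>) - (\<mu> - \<nu>)\<^sup>2 / 2) * normal_density \<nu> 1 x"
  unfolding normal_density_def
  by (simp add: exp_add[symmetric] power2_eq_square field_simps)

text \<open>Chernoff bound by recentring: relative to the normal centred at \<open>T\<close>, the
  likelihood ratio on \<open>{T..}\<close> is largest at \<open>T\<close>, and the recentred law has
  mass at most 1.\<close>

lemma normal_tail_le:
  assumes "\<mu> \<le> T"
  shows "measure (normal_distribution \<mu>) {T..} \<le> exp (- (T - \<mu>)\<^sup>2 / 2)"
proof -
  interpret N: prob_space "normal_distribution T" by (rule prob_space_normal)
  have "measure (normal_distribution \<mu>) {T..} \<le> exp (- (T - \<mu>)\<^sup>2 / 2) * measure (normal_distribution T) {T..}"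
  proof (rule measure_density_le_mult)
    fix x assume "x \<in> {T..}"
    with assms have "(\<mu> - T) * (x - T) - (\<mu> - T)\<^sup>2 / 2 \<le> - (T - \<mu>)\<^sup>2 / 2"
      by (simp add: mult_nonpos_nonneg power2_commute)
    then show "normal_density \<mu> 1 x \<le> exp (- (T - \<mu>)\<^sup>2 / 2) * normal_density T 1 x"
      by (subst normal_density_tilt[of \<mu> x T]) (intro mult_right_mono, simp_all)
  qed (use N.finite_measure_axioms in simp_all)
  also have "\<dots> \<le> exp (- (T - \<mu>)\<^sup>2 / 2) * 1"
    by (intro mult_left_mono) simp_all
  finally show ?thesis by simp
qed

text \<open>Truncation at \<open>T\<close>: on \<open>A \<inter> {..T}\<close> the likelihood ratio
  against the null is at most its value at \<open>T\<close>, and the rest of \<open>A\<close> is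
  absorbed by the tail bound.\<close>

lemma normal_measure_le:
  assumes [measurable]: "A \<in> sets borel" and "0 \<le> \<mu>" "\<mu> \<le> T"
  shows "measure (normal_distribution \<mu>) A \<le>
    exp (\<mu> * T - \<mu>\<^sup>2 / 2) * measure std_normal_distribution A + exp (- (T - \<mu>)\<^sup>2 / 2)"
proof -
  interpret N: prob_space "normal_distribution \<mu>" by (rule prob_space_normal)
  interpret S: prob_space std_normal_distribution by (rule prob_space_normal)
  have "measure (normal_distribution \<mu>) A \<le> measure (normal_distribution \<mu>) (A \<inter> {..T} \<union> {T..})"
    by (rule N.finite_measure_mono) auto
  also have "\<dots> \<le> measure (normal_distribution \<mu>) (A \<inter> {..T}) + measure (normal_distribution \<mu>) {T..}"
    by (rule measure_Un_le) auto
  also have "measure (normal_distribution \<mu>) (A \<inter> {..T}) \<le>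
      exp (\<mu> * T - \<mu>\<^sup>2 / 2) * measure std_normal_distribution (A \<inter> {..T})"
  proof (rule measure_density_le_mult)
    fix x assume "x \<in> A \<inter> {..T}"
    with assms have "(\<mu> - 0) * (x - 0) - (\<mu> - 0)\<^sup>2 / 2 \<le> \<mu> * T - \<mu>\<^sup>2 / 2"
      by (simp add: mult_left_mono)
    then show "normal_density \<mu> 1 x \<le> exp (\<mu> * T - \<mu>\<^sup>2 / 2) * std_normal_density x"
      by (subst normal_density_tilt[of \<mu> x 0]) (intro mult_right_mono, simp_all)
  qed (use S.finite_measure_axioms in simp_all)
  also have "\<dots> \<le> exp (\<mu> * T - \<mu>\<^sup>2 / 2) * measure std_normal_distribution A"
    by (intro mult_left_mono S.finite_measure_mono) auto
  also note normal_tail_le[OF \<open>\<mu> \<le> T\<close>]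
  finally show ?thesis by simp
qed

text \<open>On the unit-length interval \<open>{T..T + 1}\<close> the density is at least its value
  at the right end, so this value bounds the mass from below. The loss is of lower order in the
  exponent.\<close>

lemma normal_tail_ge:
  assumes "\<mu> \<le> T"
  shows "exp (- (T - \<mu> + 1)\<^sup>2 / 2) / sqrt (2 * pi) \<le> measure (normal_distribution \<mu>) {T..}"
proof -
  interpret N: prob_space "normal_distribution \<mu>" by (rule prob_space_normal)
  let ?c = "exp (- (T - \<mu> + 1)\<^sup>2 / 2) / sqrt (2 * pi)"
  have "ennreal ?c = (\<integral>\<^sup>+x. ennreal ?c * indicator {T..T + 1} x \<partial>lborel)"
    by (simp add: nn_integral_cmult_indicator)
  also have "\<dots> \<le> (\<integral>\<^sup>+x. ennreal (normal_density \<mu> 1 x) * indicator {T..} x \<partial>lborel)"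
  proof (rule nn_integral_mono)
    fix x
    show "ennreal ?c * indicator {T..T + 1} x \<le> ennreal (normal_density \<mu> 1 x) * indicator {T..} x"
    proof (cases "x \<in> {T..T + 1}")
      case True
      with assms have "(x - \<mu>)\<^sup>2 \<le> (T - \<mu> + 1)\<^sup>2" by (intro power_mono) auto
      with True show ?thesis
        by (auto simp: normal_density_def intro!: ennreal_leI divide_right_mono)
    qed simp
  qed
  also have "\<dots> = emeasure (normal_distribution \<mu>) {T..}"
    by (simp add: emeasure_density)
  finally show ?thesis by (simp add: N.emeasure_eq_measure)
qed

lemma measure_normal_mixture:
  assumes [measurable]: "A \<in> sets borel" and "0 \<le> \<epsilon>" "\<epsilon> \<le> 1"
  shows "measure (normal_mixture \<epsilon> \<mu>) A =
    (1 - \<epsilon>) * measure std_normal_distribution A + \<epsilon> * measure (normal_distribution \<mu>) A"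
proof -
  interpret N: prob_space "normal_distribution \<mu>" by (rule prob_space_normal)
  interpret S: prob_space std_normal_distribution by (rule prob_space_normal)
  have "emeasure (normal_mixture \<epsilon> \<mu>) A = (\<integral>\<^sup>+x. ennreal (1 - \<epsilon>) * (ennreal (std_normal_density x) * indicator A x)
      + ennreal \<epsilon> * (ennreal (normal_density \<mu> 1 x) * indicator A x) \<partial>lborel)"
    using assms unfolding normal_mixture_def
    by (auto simp: emeasure_density indicator_def ennreal_mult'[symmetric] simp flip: ennreal_plus intro!: nn_integral_cong)
  also have "\<dots> = ennreal (1 - \<epsilon>) * emeasure std_normal_distribution A
      + ennreal \<epsilon> * emeasure (normal_distribution \<mu>) A"
    by (simp add: nn_integral_add nn_integral_cmult emeasure_density)
  also have "\<dots> = ennreal ((1 - \<epsilon>) * measure std_normal_distribution A + \<epsilon> * measure (normal_distribution \<mu>) A)"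
    using assms by (simp add: N.emeasure_eq_measure S.emeasure_eq_measure ennreal_mult')
  finally show ?thesis
    by (rule measure_eq_emeasure_eq_ennreal[rotated]) (use assms in simp)
qed

section \<open>The p-value map and its law under the null\<close>

lemma p_value_eq_cdf: "p_value x = 1 - cdf std_normal_distribution x"
proof -
  interpret S: prob_space std_normal_distribution by (rule prob_space_normal)
  have "UNIV - {..x} = {x<..}" by auto
  with S.prob_compl[of "{..x}"] show ?thesis by (simp add: p_value_def cdf_def)
qed

text \<open>The normal law has no atoms, so its distribution function is continuous. This yields
  measurability and the intermediate value argument below.\<close>

lemma continuous_p_value: "isCont p_value x"
proof -
  interpret S: real_distribution std_normal_distribution by (rule real_dist_normal_dist)
  have "measure std_normal_distribution {x} = 0"
    by (simp add: measure_def emeasure_density nn_integral_indicator_singleton)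
  then have "isCont (cdf std_normal_distribution) x" by (simp add: S.isCont_cdf)
  then show ?thesis unfolding p_value_eq_cdf[abs_def] by simp
qed

lemma measurable_p_value [measurable]: "p_value \<in> borel_measurable borel"
  by (intro borel_measurable_continuous_onI continuous_at_imp_continuous_on) (simp add: continuous_p_value)

lemma antimono_p_value: "x \<le> y \<Longrightarrow> p_value y \<le> p_value x"
proof -
  interpret S: prob_space std_normal_distribution by (rule prob_space_normal)
  show "x \<le> y \<Longrightarrow> p_value y \<le> p_value x"
    unfolding p_value_def by (rule S.finite_measure_mono) auto
qed

lemma p_value_le_exp:
  assumes "0 \<le> t"
  shows "p_value t \<le> exp (- t\<^sup>2 / 2)"
proof -
  interpret S: prob_space std_normal_distribution by (rule prob_space_normal)
  have "p_value t \<le> measure std_normal_distribution {t..}"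
    unfolding p_value_def by (rule S.finite_measure_mono) auto
  with normal_tail_le[OF assms] show ?thesis by simp
qed

text \<open>For \<open>u < 1\<close>, every level \<open>v\<close> in \<open>(u, 1)\<close> is
  attained at some \<open>z\<close> by continuity; monotonicity then puts the event inside
  \<open>{z<..}\<close>, whose mass is \<open>v\<close>. Letting \<open>v\<close> decrease to
  \<open>u\<close> gives the bound.\<close>

lemma p_value_superuniform:
  assumes "0 < u"
  shows "measure std_normal_distribution {x. p_value x \<le> u} \<le> u"
proof (cases "u < 1")
  case True
  interpret S: real_distribution std_normal_distribution by (rule real_dist_normal_dist)
  show ?thesis
  proof (rule dense_ge_bounded[OF True])
    fix v assume v: "u < v" "v < 1"
    \<comment> \<open>The limits are left as differences to match 1 minus the limits of the
      distribution function.\<close>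
    have lim: "(p_value \<longlongrightarrow> 1 - 0) at_bot" "(p_value \<longlongrightarrow> 1 - 1) at_top"
      unfolding p_value_eq_cdf[abs_def]
      by (intro tendsto_intros S.cdf_lim_at_bot S.cdf_lim_at_top_prob)+
    obtain a where a: "v < p_value a"
      using order_tendstoD(1)[OF lim(1), of v] v by (auto dest: eventually_happens)
    obtain b where b: "p_value b < v"
      using order_tendstoD(2)[OF lim(2), of v] v assms by (auto dest: eventually_happens)
    have "a \<le> b" using a b antimono_p_value[of b a] by linarith
    then obtain z where z: "p_value z = v"
      using IVT2[of p_value b v a] a b continuous_p_value by fastforce
    have "{x. p_value x \<le> u} \<subseteq> {z<..}"
    proof
      fix x assume "x \<in> {x. p_value x \<le> u}"
      then show "x \<in> {z<..}" using antimono_p_value[of x z] z v by (cases "x \<le> z") auto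
    qed
    then have "measure std_normal_distribution {x. p_value x \<le> u} \<le> p_value z"
      unfolding p_value_def[of z] by (rule S.finite_measure_mono) simp
    with z show "measure std_normal_distribution {x. p_value x \<le> u} \<le> v" by simp
  qed
next
  case False
  interpret S: prob_space std_normal_distribution by (rule prob_space_normal)
  show ?thesis using False S.prob_le_1[of "{x. p_value x \<le> u}"] by linarith
qed

section \<open>Independent samples\<close>

lemma iid_sampleD:
  assumes "iid_sample M n X D"
  shows "prob_space M" "i \<in> {1..n} \<Longrightarrow> X i \<in> borel_measurable M"
    "i \<in> {1..n} \<Longrightarrow> distr M borel (X i) = D"
    "prob_space.indep_vars M (\<lambda>_. borel) X {1..n}"
proof -
  show M: "prob_space M" and indep: "prob_space.indep_vars M (\<lambda>_. borel) X {1..n}"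
    and "i \<in> {1..n} \<Longrightarrow> distr M borel (X i) = D"
    using assms unfolding iid_sample_def by auto
  show "i \<in> {1..n} \<Longrightarrow> X i \<in> borel_measurable M"
    using indep unfolding prob_space.indep_vars_def[OF M] by auto
qed

lemma iid_sample_prob_all:
  assumes iid: "iid_sample M n X D" and "S \<subseteq> {1..n}" and A: "A \<in> sets borel"
  shows "measure M {\<omega> \<in> space M. \<forall>i\<in>S. X i \<omega> \<in> A} = measure D A ^ card S"
\<comment> \<open>The empty set is separate because the product rule for independent variables is
  applied to a nonempty index set.\<close>
proof (cases "S = {}")
  case True
  then show ?thesis using iid_sampleD(1)[OF iid] by (simp add: prob_space.prob_space)
next
  case False
  interpret prob_space M using iid by (rule iid_sampleD)
  have "{\<omega> \<in> space M. \<forall>i\<in>S. X i \<omega> \<in> A} = (\<Inter>i\<in>S. X i -` A \<inter> space M)"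
    using False by auto
  also have "prob \<dots> = (\<Prod>i\<in>S. prob (X i -` A \<inter> space M))"
    using assms False finite_subset[OF \<open>S \<subseteq> {1..n}\<close>]
    by (intro indep_varsD[OF iid_sampleD(4)[OF iid]]) auto
  also have "\<dots> = (\<Prod>i\<in>S. measure D A)"
  proof (rule prod.cong)
    fix i assume "i \<in> S"
    with assms have i: "i \<in> {1..n}" by auto
    from iid_sampleD(3)[OF iid i, symmetric] iid_sampleD(2)[OF iid i] A
    show "prob (X i -` A \<inter> space M) = measure D A"
      by (simp add: measure_distr)
  qed simp
  finally show ?thesis by simp
qed

lemma sets_FDR_rejects:
  assumes iid: "iid_sample M n X D"
  shows "{\<omega> \<in> space M. FDR_rejects \<alpha> n (\<lambda>i. X i \<omega>)} \<in> sets M"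
proof -
  have "{\<omega> \<in> space M. \<forall>i\<in>S. p_value (X i \<omega>) \<le> u} \<in> sets M" if "S \<subseteq> {1..n}" for S u
  proof (intro sets.sets_Collect_finite_All)
    fix i assume "i \<in> S"
    with that have [measurable]: "X i \<in> borel_measurable M"
      using iid_sampleD(2)[OF iid] by auto
    show "{\<omega> \<in> space M. p_value (X i \<omega>) \<le> u} \<in> sets M" by measurable
  qed (use that finite_subset in auto)
  then show ?thesis
    unfolding FDR_rejects_iff by (intro sets.sets_Collect_finite_Ex) auto
qed

section \<open>Bounds on the rejection probability for a fixed sample size\<close>

text \<open>A single observation in \<open>A\<close> already forces rejection with
  \<open>k = 1\<close>, so acceptance requires all \<open>n\<close> independent observations to miss
  \<open>A\<close>.\<close>

lemma prob_FDR_rejects_ge: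
  assumes iid: "iid_sample M n X D" and n: "n \<ge> 1" and A: "A \<in> sets borel"
    and sub: "\<And>x. x \<in> A \<Longrightarrow> p_value x \<le> \<alpha> / real n"
  shows "1 - exp (- (real n * measure D A)) \<le> measure M {\<omega> \<in> space M. FDR_rejects \<alpha> n (\<lambda>i. X i \<omega>)}"
proof -
  interpret prob_space M using iid by (rule iid_sampleD)
  let ?R = "{\<omega> \<in> space M. FDR_rejects \<alpha> n (\<lambda>i. X i \<omega>)}"
  have D: "D = distr M borel (X 1)" and X1: "X 1 \<in> borel_measurable M"
    using iid_sampleD(2,3)[OF iid, of 1] n by auto
  interpret D: prob_space D unfolding D using X1 by (rule prob_space_distr)
  have "FDR_rejects \<alpha> n (\<lambda>i. X i \<omega>)" if "i \<in> {1..n}" "X i \<omega> \<in> A" for i \<omega>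
    unfolding FDR_rejects_iff using that n sub
    by (intro bexI[of _ 1] bexI[of _ "{i}"]) auto
  then have "space M - ?R \<subseteq> {\<omega> \<in> space M. \<forall>i\<in>{1..n}. X i \<omega> \<in> - A}" by blast
  moreover have "{\<omega> \<in> space M. \<forall>i\<in>{1..n}. X i \<omega> \<in> - A} \<in> sets M"
    using iid_sampleD(2)[OF iid] A
    by (intro sets.sets_Collect_finite_All) (auto intro!: measurable_sets_Collect)
  ultimately have "prob (space M - ?R) \<le> prob {\<omega> \<in> space M. \<forall>i\<in>{1..n}. X i \<omega> \<in> - A}"
    by (rule finite_measure_mono)
  also have "\<dots> = measure D (- A) ^ n"
    using A by (subst iid_sample_prob_all[OF iid]) auto
  also have "measure D (- A) = 1 - measure D A"
    using D.prob_compl[of A] A by (simp add: D Compl_eq_Diff_UNIV)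
  also have "(1 - measure D A) ^ n \<le> exp (- measure D A) ^ n"
    using exp_ge_add_one_self[of "- measure D A"] by (intro power_mono) auto
  also have "\<dots> = exp (- (real n * measure D A))"
    by (simp flip: exp_of_nat_mult)
  finally show ?thesis
    using prob_compl[OF sets_FDR_rejects[OF iid, of \<alpha>]] by simp
qed

text \<open>The term of index \<open>k\<close> in the exponential series at \<open>k\<close> is at
  most the whole sum.\<close>

lemma power_self_le_exp_fact: "real k ^ k \<le> exp (real k) * fact k"
proof -
  have "(\<Sum>i\<in>{k}. real k ^ i /\<^sub>R fact i) \<le> (\<Sum>i. real k ^ i /\<^sub>R fact i)"
    by (rule sum_le_suminf) (use summable_exp[of "real k"] in \<open>auto simp: field_simps\<close>)
  then show ?thesis by (simp add: exp_def field_simps)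
qed

text \<open>The binomial coefficient is at most \<open>n ^ k / fact k\<close>; the hypothesis turns
  \<open>(n * p) ^ k\<close> into \<open>(\<delta> * k) ^ k\<close>, and the factorial cancels
  \<open>k ^ k\<close> up to \<open>exp k\<close>.\<close>

lemma binomial_mult_power_le:
  assumes "0 \<le> p" "real n * p \<le> \<delta> * real k"
  shows "real (n choose k) * p ^ k \<le> (exp 1 * \<delta>) ^ k"
proof -
  have "(real (n choose k) * p ^ k) * fact k = real ((n choose k) * fact k) * p ^ k"
    by simp
  also have "\<dots> \<le> real (n ^ k) * p ^ k"
    using assms by (intro mult_right_mono, unfold of_nat_le_iff) (auto intro: binomial_fact_pow)
  also have "\<dots> = (real n * p) ^ k" by (simp add: power_mult_distrib)
  also have "\<dots> \<le> (\<delta> * real k) ^ k" using assms by (intro power_mono) auto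
  also have "\<dots> = \<delta> ^ k * real k ^ k" by (simp add: power_mult_distrib)
  also have "\<dots> \<le> \<delta> ^ k * (exp (real k) * fact k)"
  \<comment> \<open>The sign of \<delta> follows from the hypotheses only for positive
    \<open>k\<close>; for \<open>k = 0\<close> both sides equal 1.\<close>
  proof (cases "k = 0")
    case False
    have "0 \<le> \<delta> * real k" using assms by (meson mult_nonneg_nonneg of_nat_0_le_iff order_trans)
    then have "0 \<le> \<delta>" using False by (simp add: zero_le_mult_iff)
    then show ?thesis by (intro mult_left_mono power_self_le_exp_fact) auto
  qed simp
  also have "\<dots> = (exp 1 * \<delta>) ^ k * fact k"
    by (simp add: power_mult_distrib flip: exp_of_nat_mult)
  finally show ?thesis by simp
qed

text \<open>For each \<open>k\<close>, all subsets of size \<open>k\<close> contribute equally, and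
  the binomial estimate bounds their total by the power \<open>k\<close> of
  \<open>exp 1 * \<delta>\<close>. With ratio at most 1/2, the geometric series is at most twice its
  first term.\<close>

lemma prob_FDR_rejects_le:
  assumes iid: "iid_sample M n X D" and small: "0 \<le> \<delta>" "exp 1 * \<delta> \<le> 1/2"
    and bound: "\<And>k. k \<in> {1..n} \<Longrightarrow>
      real n * measure D {x. p_value x \<le> \<alpha> * real k / real n} \<le> \<delta> * real k"
  shows "measure M {\<omega> \<in> space M. FDR_rejects \<alpha> n (\<lambda>i. X i \<omega>)} \<le> 2 * exp 1 * \<delta>"
proof -
  interpret prob_space M using iid by (rule iid_sampleD)
  let ?A = "\<lambda>k. {x. p_value x \<le> \<alpha> * real k / real n}"
  let ?N = "\<lambda>k. {S. S \<subseteq> {1..n} \<and> card S = k}"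
  let ?E = "\<lambda>k S. {\<omega> \<in> space M. \<forall>i\<in>S. X i \<omega> \<in> ?A k}"
  let ?q = "exp 1 * \<delta>"
  have E: "?E k S \<in> sets M" if "S \<in> ?N k" for k S
  proof (intro sets.sets_Collect_finite_All)
    fix i assume "i \<in> S"
    with that have [measurable]: "X i \<in> borel_measurable M"
      using iid_sampleD(2)[OF iid] by auto
    show "{\<omega> \<in> space M. X i \<omega> \<in> ?A k} \<in> sets M" by simp
  qed (use that finite_subset in auto)
  have fin: "finite (?N k)" for k
    by (rule finite_subset[of _ "Pow {1..n}"]) auto
  have "{\<omega> \<in> space M. FDR_rejects \<alpha> n (\<lambda>i. X i \<omega>)} = (\<Union>k\<in>{1..n}. \<Union>S\<in>?N k. ?E k S)"
    unfolding FDR_rejects_iff by auto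
  also have "prob \<dots> \<le> (\<Sum>k\<in>{1..n}. prob (\<Union>S\<in>?N k. ?E k S))"
    using E fin by (intro finite_measure_subadditive_finite) (auto intro!: sets.finite_UN)
  also have "\<dots> \<le> (\<Sum>k\<in>{1..n}. ?q ^ k)"
  proof (rule sum_mono)
    fix k assume k: "k \<in> {1..n}"
    have "prob (\<Union>S\<in>?N k. ?E k S) \<le> (\<Sum>S\<in>?N k. prob (?E k S))"
      using E fin by (intro finite_measure_subadditive_finite) auto
    also have "\<dots> = (\<Sum>S\<in>?N k. measure D (?A k) ^ k)"
      by (intro sum.cong refl) (subst iid_sample_prob_all[OF iid], auto)
    also have "\<dots> = real (n choose k) * measure D (?A k) ^ k"
      by (simp add: n_subsets[of "{1..n}", simplified])
    also have "\<dots> \<le> ?q ^ k"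
      by (rule binomial_mult_power_le) (use bound[OF k] in auto)
    finally show "prob (\<Union>S\<in>?N k. ?E k S) \<le> ?q ^ k" .
  qed
  also have "\<dots> \<le> ?q / (1 - ?q)"
    using small by (auto simp: sum_gp divide_right_mono)
  also have "\<dots> \<le> 2 * ?q"
    using small mult_left_mono[of "2 * ?q" 1 ?q] by (simp add: field_simps)
  finally show ?thesis by simp
qed

section \<open>Asymptotics above and below the boundary\<close>

lemma tendsto_prob_FDR_rejects_1:
  fixes \<beta> r :: real and \<alpha> :: "nat \<Rightarrow> real" and M :: "nat \<Rightarrow> 'a measure"
  assumes beta: "0 < \<beta>" "\<beta> < 1" and r: "0 < r" "r < 1" "r > (1 - sqrt (1 - \<beta>))\<^sup>2"
    and level: "\<And>n. n \<ge> 1 \<Longrightarrow> 0 < \<alpha> n"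
    and slow: "(\<lambda>n. ln (1 / \<alpha> n)) \<in> o(\<lambda>n. ln (real n))"
    and H1: "\<And>n. n \<ge> 1 \<Longrightarrow> iid_sample (M n) n (X n)
        (normal_mixture (real n powr (- \<beta>)) (sqrt (2 * r * ln (real n))))"
  shows "(\<lambda>n. measure (M n) {\<omega> \<in> space (M n). FDR_rejects (\<alpha> n) n (\<lambda>i. X n i \<omega>)}) \<longlonglongrightarrow> 1"
proof -
  define a where "a = sqrt (1 - \<beta>)"
  \<comment> \<open>The midpoint of 1 and \<open>sqrt r + a\<close>. Above the boundary 1 is the
    smaller of the two, so \<open>b > 1\<close> while \<open>d < a\<close>.\<close>
  define b where "b = (1 + sqrt r + a) / 2"
  define d where "d = b - sqrt r"
  \<comment> \<open>The leading exponent of \<open>n\<close> in the expected number of shifted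
    observations beyond \<open>T\<close>: \<open>n * \<epsilon>\<close> gives
    \<open>1 - \<beta>\<close>, and the tail at distance \<open>d * sqrt (2 * ln n)\<close> from the
    mean costs \<open>d\<^sup>2\<close>.\<close>
  define c where "c = 1 - \<beta> - d\<^sup>2"
  \<comment> \<open>The square root term and the 1/2 come from expanding
    \<open>(T - \<mu> + 1)\<^sup>2 / 2\<close> in the lower tail bound.\<close>
  define g where "g n = 1 - exp (- (exp (c * ln (real n) - d * sqrt (2 * ln (real n)) - 1 / 2) / sqrt (2 * pi)))"
    for n :: nat
  have "1 - a < sqrt r"
    using r(3) real_less_rsqrt[of "1 - a" r] unfolding a_def by simp
  moreover have "sqrt r < 1" using r by simp
  moreover have "0 < a" using beta by (simp add: a_def)
  moreover have "2 * b = 1 + sqrt r + a" by (simp add: b_def)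
  moreover have "d = b - sqrt r" by (rule d_def)
  ultimately have b: "1 < b" and d0: "0 < d" and da: "d < a" by - linarith+
  have "d\<^sup>2 < a\<^sup>2" using d0 da by (intro power_strict_mono) auto
  then have c: "0 < c" using beta by (simp add: c_def a_def)
  have "sqrt (2 * pi) > 0" by simp
  with c d0 have "g \<longlonglongrightarrow> 1" unfolding g_def by real_asymp
  moreover have ge: "\<forall>\<^sub>F n in sequentially.
      g n \<le> measure (M n) {\<omega> \<in> space (M n). FDR_rejects (\<alpha> n) n (\<lambda>i. X n i \<omega>)}"
  proof -
    \<comment> \<open>Used as the constant in the little-o condition: eventually
      \<open>ln (1 / \<alpha> n)\<close> is at most \<open>(b\<^sup>2 - 1) * ln n\<close>, so
      \<open>\<alpha> n / n\<close> is at least \<open>n\<close> to the power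
      \<open>- b\<^sup>2\<close>, which bounds the p-value at \<open>T\<close>.\<close>
    have "0 < b\<^sup>2 - 1" using b by simp
    from landau_o.smallD[OF slow this] eventually_ge_at_top[of 2] show ?thesis
    proof eventually_elim
      case (elim n)
      let ?L = "ln (real n)" and ?\<epsilon> = "real n powr (- \<beta>)" and ?\<mu> = "sqrt (2 * r * ln (real n))"
      let ?T = "b * sqrt (2 * ?L)"
      let ?D = "normal_mixture ?\<epsilon> ?\<mu>"
      have L: "0 < ?L" and \<alpha>: "0 < \<alpha> n" using elim level by auto
      have \<epsilon>: "?\<epsilon> = exp (- \<beta> * ?L)" using elim by (simp add: powr_def)
      have T\<mu>: "?T - ?\<mu> = d * sqrt (2 * ?L)"
        by (simp add: d_def real_sqrt_mult algebra_simps)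
      have "p_value x \<le> \<alpha> n / real n" if "x \<in> {?T..}" for x
      proof -
        have "p_value x \<le> p_value ?T" using that by (intro antimono_p_value) auto
        also have "\<dots> \<le> exp (- ?T\<^sup>2 / 2)" using b L by (intro p_value_le_exp) auto
        also have "\<dots> \<le> exp (ln (\<alpha> n / real n))"
        proof -
          have "- ln (\<alpha> n) \<le> (b\<^sup>2 - 1) * ?L" using elim \<alpha> L by (simp add: ln_div)
          then show ?thesis using \<alpha> L elim(2) by (simp add: power_mult_distrib ln_div algebra_simps)
        qed
        also have "\<dots> = \<alpha> n / real n" using \<alpha> elim by simp
        finally show ?thesis .
      qed
      then have "1 - exp (- (real n * measure ?D {?T..}))
          \<le> measure (M n) {\<omega> \<in> space (M n). FDR_rejects (\<alpha> n) n (\<lambda>i. X n i \<omega>)}"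
        using elim by (intro prob_FDR_rejects_ge[OF H1]) auto
      moreover have "exp (c * ?L - d * sqrt (2 * ?L) - 1 / 2) / sqrt (2 * pi) \<le> real n * measure ?D {?T..}"
      proof -
        have e: "c * ?L - d * sqrt (2 * ?L) - 1 / 2 = ?L + - \<beta> * ?L + - (?T - ?\<mu> + 1)\<^sup>2 / 2"
          using L unfolding T\<mu> by (simp add: c_def power2_sum power_mult_distrib field_simps)
        have "exp (c * ?L - d * sqrt (2 * ?L) - 1 / 2) / sqrt (2 * pi) =
            real n * (?\<epsilon> * (exp (- (?T - ?\<mu> + 1)\<^sup>2 / 2) / sqrt (2 * pi)))"
          unfolding e exp_add \<epsilon> using elim by simp
        also have "\<dots> \<le> real n * (?\<epsilon> * measure (normal_distribution ?\<mu>) {?T..})"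
          using T\<mu> d0 L by (intro mult_left_mono normal_tail_ge) (auto simp: diff_eq_eq)
        \<comment> \<open>The nonnegative null component of the mixture is dropped.\<close>
        also have "\<dots> \<le> real n * measure ?D {?T..}"
        proof -
          have "0 \<le> ?\<epsilon>" "?\<epsilon> \<le> 1" using beta L unfolding \<epsilon> by auto
          then show ?thesis
            by (intro mult_left_mono) (simp_all add: measure_normal_mixture)
        qed
        finally show ?thesis .
      qed
      ultimately show ?case unfolding g_def by (smt (verit) exp_less_mono)
    qed
  qed
  moreover have "\<forall>\<^sub>F n in sequentially.
      measure (M n) {\<omega> \<in> space (M n). FDR_rejects (\<alpha> n) n (\<lambda>i. X n i \<omega>)} \<le> 1"
    using eventually_ge_at_top[of 1]
    by eventually_elim (metis H1 iid_sampleD(1) prob_space.prob_le_1)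
  ultimately show ?thesis
    by (intro tendsto_sandwich[OF ge, of "\<lambda>_. 1"]) auto
qed

lemma tendsto_prob_FDR_rejects_0:
  fixes \<beta> r :: real and \<alpha> :: "nat \<Rightarrow> real" and M :: "nat \<Rightarrow> 'a measure"
  assumes beta: "0 < \<beta>" "\<beta> < 1" and r: "0 < r" "r < 1" "r < (1 - sqrt (1 - \<beta>))\<^sup>2"
    and level: "\<And>n. n \<ge> 1 \<Longrightarrow> 0 < \<alpha> n \<and> \<alpha> n < 1"
    and \<alpha>0: "\<alpha> \<longlonglongrightarrow> 0"
    and H1: "\<And>n. n \<ge> 1 \<Longrightarrow> iid_sample (M n) n (X n)
        (normal_mixture (real n powr (- \<beta>)) (sqrt (2 * r * ln (real n))))"
  shows "(\<lambda>n. measure (M n) {\<omega> \<in> space (M n). FDR_rejects (\<alpha> n) n (\<lambda>i. X n i \<omega>)}) \<longlonglongrightarrow> 0"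
proof -
  \<comment> \<open>This equals \<open>(1 - sqrt r)\<^sup>2 - (1 - \<beta>)\<close>, which is
    positive below the boundary.\<close>
  define c where "c = \<beta> + r - 2 * sqrt r"
  \<comment> \<open>The null component contributes \<open>\<alpha> n\<close>; the two exponentials
    come from the shifted component below and above \<open>T\<close>.\<close>
  define \<delta> where "\<delta> n = \<alpha> n + 2 * exp (- c * ln (real n))" for n
  have "sqrt r < 1 - sqrt (1 - \<beta>)"
    using r beta by (intro real_less_lsqrt) auto
  then have "(sqrt (1 - \<beta>))\<^sup>2 < (1 - sqrt r)\<^sup>2"
    using beta by (intro power_strict_mono) auto
  then have c: "0 < c" using r beta by (simp add: c_def power2_diff)
  have c_alt: "c = \<beta> + (sqrt r)\<^sup>2 - 2 * sqrt r"
    using r(1) by (simp add: c_def)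
  have exponent: "l + - \<beta> * l + - ((1 - s)\<^sup>2) * l = - (\<beta> + s\<^sup>2 - 2 * s) * l" for l s :: real
    by (simp add: power2_diff algebra_simps)
  from c have "(\<lambda>n. 2 * exp (- c * ln (real n))) \<longlonglongrightarrow> 0" by real_asymp
  from tendsto_add[OF \<alpha>0 this] have \<delta>0: "\<delta> \<longlonglongrightarrow> 0" by (simp add: \<delta>_def[abs_def])
  have "\<forall>\<^sub>F n in sequentially. \<delta> n < 1 / (2 * exp 1)"
    by (rule order_tendstoD(2)[OF \<delta>0]) simp
  then have "\<forall>\<^sub>F n in sequentially.
      measure (M n) {\<omega> \<in> space (M n). FDR_rejects (\<alpha> n) n (\<lambda>i. X n i \<omega>)} \<le> 2 * exp 1 * \<delta> n"
    \<comment> \<open>From \<open>n = 2\<close> on, \<open>ln n\<close> is positive.\<close>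
    using eventually_ge_at_top[of 2]
  proof eventually_elim
    case (elim n)
    let ?L = "ln (real n)" and ?\<epsilon> = "real n powr (- \<beta>)" and ?\<mu> = "sqrt (2 * r * ln (real n))"
    let ?T = "sqrt (2 * ?L)"
    let ?D = "normal_mixture ?\<epsilon> ?\<mu>"
    have L: "0 < ?L" and \<alpha>: "0 < \<alpha> n" "\<alpha> n < 1" using elim level[of n] by auto
    have \<epsilon>: "?\<epsilon> = exp (- \<beta> * ?L)" using elim by (simp add: powr_def)
    have \<epsilon>1: "0 \<le> ?\<epsilon>" "?\<epsilon> \<le> 1" using beta L unfolding \<epsilon> by auto
    have \<mu>: "?\<mu> = sqrt r * ?T" by (simp add: real_sqrt_mult)
    have "?\<mu> * ?T - ?\<mu>\<^sup>2 / 2 = (2 * sqrt r - r) * ?L"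
      using L r unfolding \<mu> by (simp add: power_mult_distrib algebra_simps)
    then have tilt: "?\<epsilon> * exp (?\<mu> * ?T - ?\<mu>\<^sup>2 / 2) = exp (- c * ?L)"
      unfolding \<epsilon> by (simp add: c_def algebra_simps flip: exp_add)
    have T\<mu>: "?T - ?\<mu> = (1 - sqrt r) * ?T" unfolding \<mu> by (simp only: left_diff_distrib mult_1_left)
    have sq: "- (?T - ?\<mu>)\<^sup>2 / 2 = - ((1 - sqrt r)\<^sup>2) * ?L"
    proof -
      have "?T\<^sup>2 = 2 * ?L" using L by (intro real_sqrt_pow2) simp
      then show ?thesis unfolding T\<mu> power_mult_distrib by algebra
    qed
    have "real n * (?\<epsilon> * exp (- (?T - ?\<mu>)\<^sup>2 / 2)) = exp (?L + - \<beta> * ?L + - ((1 - sqrt r)\<^sup>2) * ?L)"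
    proof -
      have "exp ?L = real n" using elim by simp
      then show ?thesis unfolding exp_add \<epsilon> sq by (simp only: mult.assoc)
    qed
    also have "?L + - \<beta> * ?L + - ((1 - sqrt r)\<^sup>2) * ?L = - c * ?L"
      unfolding c_alt by (rule exponent)
    finally have tail: "real n * (?\<epsilon> * exp (- (?T - ?\<mu>)\<^sup>2 / 2)) = exp (- c * ?L)" .
    have "?\<mu> \<le> ?T" using r L by simp
    show ?case
    proof (rule prob_FDR_rejects_le[OF H1])
      show "0 \<le> \<delta> n" using \<alpha> by (simp add: \<delta>_def)
      show "exp 1 * \<delta> n \<le> 1 / 2" using elim by (simp add: field_simps)
      fix k assume k: "k \<in> {1..n}"
      let ?u = "\<alpha> n * real k / real n"
      let ?A = "{x. p_value x \<le> ?u}"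
      have nu: "real n * ?u = \<alpha> n * real k" using elim by simp
      have u: "0 < ?u" using \<alpha> k elim by simp
      have A: "?A \<in> sets borel" by simp
      have S: "measure std_normal_distribution ?A \<le> ?u" using u by (rule p_value_superuniform)
      have "measure (normal_distribution ?\<mu>) ?A \<le> exp (?\<mu> * ?T - ?\<mu>\<^sup>2 / 2) * measure std_normal_distribution ?A
          + exp (- (?T - ?\<mu>)\<^sup>2 / 2)"
        using r L \<open>?\<mu> \<le> ?T\<close> by (intro normal_measure_le[OF A]) auto
      also have "\<dots> \<le> exp (?\<mu> * ?T - ?\<mu>\<^sup>2 / 2) * ?u + exp (- (?T - ?\<mu>)\<^sup>2 / 2)"
        using S by (intro add_right_mono mult_left_mono) auto
      finally have N: "measure (normal_distribution ?\<mu>) ?A \<le> exp (?\<mu> * ?T - ?\<mu>\<^sup>2 / 2) * ?u + exp (- (?T - ?\<mu>)\<^sup>2 / 2)" .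
      have "measure ?D ?A \<le> 1 * ?u + ?\<epsilon> * (exp (?\<mu> * ?T - ?\<mu>\<^sup>2 / 2) * ?u + exp (- (?T - ?\<mu>)\<^sup>2 / 2))"
        unfolding measure_normal_mixture[OF A \<epsilon>1]
        using \<epsilon>1 S N by (intro add_mono mult_mono) auto
      then have "real n * measure ?D ?A \<le> real n * (1 * ?u + ?\<epsilon> * (exp (?\<mu> * ?T - ?\<mu>\<^sup>2 / 2) * ?u + exp (- (?T - ?\<mu>)\<^sup>2 / 2)))"
        by (rule mult_left_mono) simp
      also have "\<dots> = real n * ?u + (?\<epsilon> * exp (?\<mu> * ?T - ?\<mu>\<^sup>2 / 2)) * (real n * ?u)
          + real n * (?\<epsilon> * exp (- (?T - ?\<mu>)\<^sup>2 / 2))"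
        by (simp only: algebra_simps mult_1)
      also have "\<dots> = \<alpha> n * real k + exp (- c * ?L) * (\<alpha> n * real k) + exp (- c * ?L)"
        unfolding nu tilt tail ..
      \<comment> \<open>The second term uses \<open>\<alpha> n < 1\<close>, and the third, which is
        free of \<open>k\<close>, uses that \<open>k\<close> is at least 1.\<close>
      also have "\<dots> \<le> \<alpha> n * real k + exp (- c * ?L) * real k + exp (- c * ?L) * real k"
        using \<alpha> k by (intro add_mono mult_left_mono) auto
      also have "\<dots> = \<delta> n * real k" by (simp add: \<delta>_def algebra_simps)
      finally show "real n * measure ?D ?A \<le> \<delta> n * real k" .
    qed (use elim in simp)
  qed
  moreover have "(\<lambda>n. 2 * exp 1 * \<delta> n) \<longlonglongrightarrow> 0"
    using tendsto_mult_left[OF \<delta>0, of "2 * exp 1"] by simp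
  ultimately show ?thesis
    by (rule tendsto_sandwich[rotated, OF _ tendsto_const]) simp
qed

theorem theorem1p4:
  fixes \<beta> r :: real
    and \<alpha> :: "nat \<Rightarrow> real"
    and M :: "nat \<Rightarrow> 'a measure"
    and X :: "nat \<Rightarrow> nat \<Rightarrow> 'a \<Rightarrow> real"
  assumes beta: "1/2 < \<beta>" "\<beta> < 1"
    and r: "0 < r" "r < 1"
    and level: "\<And>n. n \<ge> 1 \<Longrightarrow> 0 < \<alpha> n \<and> \<alpha> n < 1"
    and slow: "tends_to_0_slowly_enough \<alpha>"
    and H1: "\<And>n. n \<ge> 1 \<Longrightarrow>
      iid_sample (M n) n (X n)
        (normal_mixture (real n powr (- \<beta>)) (sqrt (2 * r * ln (real n))))"
  shows "(r > (1 - sqrt (1 - \<beta>))\<^sup>2 \<longrightarrow>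
      (\<lambda>n. measure (M n) {\<omega> \<in> space (M n). FDR_rejects (\<alpha> n) n (\<lambda>i. X n i \<omega>)}) \<longlonglongrightarrow> 1)
    \<and> (r < (1 - sqrt (1 - \<beta>))\<^sup>2 \<longrightarrow>
      (\<lambda>n. measure (M n) {\<omega> \<in> space (M n). FDR_rejects (\<alpha> n) n (\<lambda>i. X n i \<omega>)}) \<longlonglongrightarrow> 0)"
proof (intro conjI impI)
  note slow = slow[unfolded tends_to_0_slowly_enough_def]
  have beta: "0 < \<beta>" "\<beta> < 1" using beta by auto
  have pos: "0 < \<alpha> n" if "n \<ge> 1" for n
    using level that by blast
  show "(\<lambda>n. measure (M n) {\<omega> \<in> space (M n). FDR_rejects (\<alpha> n) n (\<lambda>i. X n i \<omega>)}) \<longlonglongrightarrow> 1"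
    if "r > (1 - sqrt (1 - \<beta>))\<^sup>2"
    by (rule tendsto_prob_FDR_rejects_1[OF beta r that pos conjunct2[OF slow] H1])
  show "(\<lambda>n. measure (M n) {\<omega> \<in> space (M n). FDR_rejects (\<alpha> n) n (\<lambda>i. X n i \<omega>)}) \<longlonglongrightarrow> 0"
    if "r < (1 - sqrt (1 - \<beta>))\<^sup>2"
    by (rule tendsto_prob_FDR_rejects_0[OF beta r that level conjunct1[OF slow] H1])
qed

end
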